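(* Let $L_1,L_2,C_1,C_2,R>0$ and let $V_{\mathrm{in}}$ be a real constant. Let $P$, $A(\mu)$ and $B$ be the matrices given in the context. Let $0<\varepsilon\le 0.5$, $\bar\mu:=0.5-\varepsilon$ and $\mathbb{U}:=[-\bar\mu,\bar\mu]$. Let $H$ be the symmetric matrix $$H:=\begin{bmatrix} 0&0&h_{13}&h_{14} \\ 0&0&h_{23}&h_{24} \\ {h_{13}}&h_{23}&0&0 \\ {h_{14}}&h_{24}&0&0 \end{bmatrix}$$ whose entries satisfy $$h_{13}<0,\qquad h_{14}=-\frac{C_2(h_{13}-h_{23})}{2C_1},\qquad h_{23}<\frac{L_2}{L_1}\,\frac{1-\varepsilon}{\varepsilon}\,h_{13}<0,$$ $$h_{24}>\frac{C_2}{C_1}\,\frac{(h_{23}-h_{13})^2\bar\mu^2+h_{13}h_{23}}{-4\varepsilon h_{13}}>0.$$ For $\xi>0$ put $\tilde P_\xi:=P+\xi H$ and $V_\xi(x):=x'\tilde P_\xi x$. Then: (a) For every sufficiently small $\xi>0$ we have $\tilde P_\xi>0$, and there is $\alpha(\xi)>0$ such that for all $\mu\in\mathbb{U}$ $$A(\mu)'\tilde P_\xi+\tilde P_\xi A(\mu)\le-\alpha(\xi)\,\mathrm{I}<0 .$$ Consequently, the origin of $\dot x(t)=A(\mu(t))x(t)$ is globally exponentially stable, uniformly with respect to $\mu$: there exist $K,\lambda>0$ such that for every $\mu(\cdot)$ with $\mu(t)\in\mathbb{U}$ for all $t\ge0$, every trajectory satisfies $\|x(t)\|\le K\|x(0)\|e^{-\lambda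 t}$ for all $t\ge 0$. (b) There exist positive constants $K,\lambda,G$ such that, for every $\mu(\cdot)$ with $\mu(t)\in\mathbb{U}$ for all $t\ge0$ and every scalar input $u(\cdot)$, every trajectory of $\dot x(t)=A(\mu(t))x(t)+Bu(t)$ satisfies, for all $t\ge0$, $$\|x(t)\|\le K\|x(0)\|e^{-\lambda t}+G\sup_{0\le\tau\le t}\|u(\tau)\| .$$ Consequently, this system is input-to-state stable with respect to the input $u$, with exponential decay rate and linear asymptotic gain, uniformly with respect to $\mu$. (c) With the same constants $K,\lambda,G$ as in (b), for every $\mu(\cdot)$ with $\mu(t)\in\mathbb{U}$ for all $t\ge0$, every trajectory of $\dot x(t)=A(\mu(t))x(t)+B\mu(t)$ satisfies $\|x(t)\|\le K\|x(0)\|e^{-\lambda t}+G\bar\mu$ for all $t\ge0$.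
   Context: $M'$ denotes the transpose of $M$, $\mathrm{I}$ the identity matrix, and $\|\cdot\|$ the Euclidean norm on vectors (absolute value on scalars). For symmetric matrices, inequalities such as $M>0$, $M<0$ and $M\le N$ are in the sense of definiteness (Loewner order). Matrices: $P:=\frac12\operatorname{diag}(L_1,L_2,C_1,C_2)$; for $\mu\in[-0.5,0.5]$, $$A(\mu):=\tfrac12P^{-1}\left(A_0^q+\mu E_0^q\right),\qquad A_0^q=\begin{bmatrix}0&0&-0.5&0\\0&0&0.5&1\\0.5&-0.5&0&0\\0&-1&0&-1/R\end{bmatrix},\qquad E_0^q=\begin{bmatrix}0&0&1&0\\0&0&1&0\\-1&-1&0&0\\0&0&0&0\end{bmatrix};$$ $$B:=\tfrac12P^{-1}\,[\,2V_{\mathrm{in}}\ \ 2V_{\mathrm{in}}\ \ 0\ \ 0\,]'.$$ A trajectory is a locally absolutely continuous function $x:[0,\infty)\to\mathbb{R}^4$ satisfying the stated differential equation for almost every $t\ge 0$. (The system $\dot x=A(\mu)x+B\mu$ is the averaged model of a semi-quasi-Z-source inverter with resistive load $R$ and duty cycle $d(t)=\mu(t)+0.5\in[\varepsilon,1-\varepsilon]$.) *)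

theory Defs
  imports "HOL-Analysis.Analysis"
begin

definition pos_definite :: "real^'n^'n \<Rightarrow> bool" where
  "pos_definite M \<longleftrightarrow> transpose M = M \<and> (\<forall>v. v \<noteq> 0 \<longrightarrow> 0 < v \<bullet> (M *v v))"

definition pos_semidefinite :: "real^'n^'n \<Rightarrow> bool" where
  "pos_semidefinite M \<longleftrightarrow> transpose M = M \<and> (\<forall>v. 0 \<le> v \<bullet> (M *v v))"

definition loewner_less :: "real^'n^'n \<Rightarrow> real^'n^'n \<Rightarrow> bool"  (infix \<open>\<prec>\<close> 50) where
  "M \<prec> N \<longleftrightarrow> transpose M = M \<and> transpose N = N \<and> pos_definite (N - M)"

definition loewner_le :: "real^'n^'n \<Rightarrow> real^'n^'n \<Rightarrow> bool"  (infix \<open>\<preceq>\<close> 50) where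
  "M \<preceq> N \<longleftrightarrow> transpose M = M \<and> transpose N = N \<and> pos_semidefinite (N - M)"

text \<open>A finite set of non-overlapping compact intervals is a division of its own union. The
  endpoints of an interval \<open>k\<close> are \<open>Inf k\<close> and \<open>Sup k\<close>.\<close>

definition abs_continuous_on :: "real set \<Rightarrow> (real \<Rightarrow> 'a::real_normed_vector) \<Rightarrow> bool" where
  "abs_continuous_on S f \<longleftrightarrow>
     (\<forall>e>0. \<exists>d>0. \<forall>D. D division_of \<Union>D \<and> \<Union>D \<subseteq> S \<and> (\<Sum>k\<in>D. Sup k - Inf k) < d
        \<longrightarrow> (\<Sum>k\<in>D. norm (f (Sup k) - f (Inf k))) < e)"

text \<open>Only the values of \<open>x\<close> on \<open>[0, \<infinity>)\<close> matter.\<close>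

definition trajectory :: "(real \<Rightarrow> 'a \<Rightarrow> 'a) \<Rightarrow> (real \<Rightarrow> 'a::real_normed_vector) \<Rightarrow> bool" where
  "trajectory f x \<longleftrightarrow>
     (\<forall>T\<ge>0. abs_continuous_on {0..T} x) \<and>
     (AE t in lebesgue. 0 \<le> t \<longrightarrow> (x has_vector_derivative f t (x t)) (at t within {0..}))"

definition class_K :: "(real \<Rightarrow> real) \<Rightarrow> bool" where
  "class_K \<gamma> \<longleftrightarrow> continuous_on {0..} \<gamma> \<and> strict_mono_on {0..} \<gamma> \<and> \<gamma> 0 = 0"

definition class_KL :: "(real \<Rightarrow> real \<Rightarrow> real) \<Rightarrow> bool" where
  "class_KL \<beta> \<longleftrightarrow>
     continuous_on ({0..} \<times> {0..}) (\<lambda>(r, s). \<beta> r s) \<and>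
     (\<forall>s\<ge>0. class_K (\<lambda>r. \<beta> r s)) \<and>
     (\<forall>r\<ge>0. antimono_on {0..} (\<beta> r) \<and> (\<beta> r \<longlongrightarrow> 0) at_top)"

text \<open>Input-to-state stability of \<open>x' = f (\<mu> t) (u t) x\<close> with respect to the scalar input \<open>u\<close>,
  uniformly in \<open>\<mu>\<close> with values in \<open>U\<close>, with comparison functions \<open>\<beta>\<close> and \<open>\<gamma>\<close>. Inputs are
  locally bounded, so that the supremum below is finite and can be an argument of \<open>\<gamma>\<close>.\<close>

definition uniformly_ISS ::
  "real set \<Rightarrow> (real \<Rightarrow> real \<Rightarrow> 'a \<Rightarrow> 'a::real_normed_vector) \<Rightarrow>
   (real \<Rightarrow> real \<Rightarrow> real) \<Rightarrow> (real \<Rightarrow> real) \<Rightarrow> bool" where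
  "uniformly_ISS U f \<beta> \<gamma> \<longleftrightarrow>
     class_KL \<beta> \<and> class_K \<gamma> \<and>
     (\<forall>\<mu> u x. (\<forall>t\<ge>0. \<mu> t \<in> U) \<longrightarrow> (\<forall>t\<ge>0. bdd_above ((\<lambda>\<tau>. \<bar>u \<tau>\<bar>) ` {0..t})) \<longrightarrow>
        trajectory (\<lambda>t. f (\<mu> t) (u t)) x \<longrightarrow>
        (\<forall>t\<ge>0. norm (x t) \<le> \<beta> (norm (x 0)) t + \<gamma> (SUP \<tau>\<in>{0..t}. \<bar>u \<tau>\<bar>)))"

definition P_mat :: "real \<Rightarrow> real \<Rightarrow> real \<Rightarrow> real \<Rightarrow> real^4^4" where
  "P_mat L\<^sub>1 L\<^sub>2 C\<^sub>1 C\<^sub>2 = (1/2) *\<^sub>R vector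
     [vector [L\<^sub>1, 0, 0, 0],
      vector [0, L\<^sub>2, 0, 0],
      vector [0, 0, C\<^sub>1, 0],
      vector [0, 0, 0, C\<^sub>2]]"

definition A0q :: "real \<Rightarrow> real^4^4" where
  "A0q R = vector
     [vector [0, 0, -(1/2), 0],
      vector [0, 0, 1/2, 1],
      vector [1/2, -(1/2), 0, 0],
      vector [0, -1, 0, -(1/R)]]"

definition E0q :: "real^4^4" where
  "E0q = vector
     [vector [0, 0, 1, 0],
      vector [0, 0, 1, 0],
      vector [-1, -1, 0, 0],
      vector [0, 0, 0, 0]]"

definition A_mat :: "real \<Rightarrow> real \<Rightarrow> real \<Rightarrow> real \<Rightarrow> real \<Rightarrow> real \<Rightarrow> real^4^4" where
  "A_mat L\<^sub>1 L\<^sub>2 C\<^sub>1 C\<^sub>2 R \<mu> =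
     (1/2) *\<^sub>R (matrix_inv (P_mat L\<^sub>1 L\<^sub>2 C\<^sub>1 C\<^sub>2) ** (A0q R + \<mu> *\<^sub>R E0q))"

definition B_vec :: "real \<Rightarrow> real \<Rightarrow> real \<Rightarrow> real \<Rightarrow> real \<Rightarrow> real^4" where
  "B_vec L\<^sub>1 L\<^sub>2 C\<^sub>1 C\<^sub>2 V\<^sub>i\<^sub>n =
     (1/2) *\<^sub>R (matrix_inv (P_mat L\<^sub>1 L\<^sub>2 C\<^sub>1 C\<^sub>2) *v vector [2 * V\<^sub>i\<^sub>n, 2 * V\<^sub>i\<^sub>n, 0, 0])"

definition H_mat :: "real \<Rightarrow> real \<Rightarrow> real \<Rightarrow> real \<Rightarrow> real^4^4" where
  "H_mat h13 h14 h23 h24 = vector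
     [vector [0, 0, h13, h14],
      vector [0, 0, h23, h24],
      vector [h13, h23, 0, 0],
      vector [h14, h24, 0, 0]]"

end

theory Submission
  imports Defs
begin

text \<open>Since \<open>A\<^sub>0\<^sup>q\<close> and \<open>E\<^sub>0\<^sup>q\<close> are skew-symmetric up to the load entry, \<open>P\<close> alone gives
  \<open>A(\<mu>)' P + P A(\<mu>) = - diag(0, 0, 0, 1/R)\<close>, which is only semidefinite. The conditions on \<open>H\<close> make
  the form of \<open>A(\<mu>)' H + H A(\<mu>)\<close> negative on the hyperplane \<open>x\<^sub>4 = 0\<close>: there it splits into an
  \<open>x\<^sub>3\<^sup>2\<close> term, negative by the bound on \<open>h\<^sub>2\<^sub>3\<close>, and a binary form in \<open>(x\<^sub>1, x\<^sub>2)\<close>, whose discriminant is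
  controlled by the bound on \<open>h\<^sub>2\<^sub>4\<close> (\<open>h\<^sub>1\<^sub>4\<close> is chosen to make its mixed coefficient proportional to \<open>\<mu>\<close>).
  By compactness a small multiple of \<open>H\<close> then makes the decay strict, uniformly in \<open>\<mu>\<close>, and the
  estimates follow from a comparison argument for \<open>V\<^sub>\<xi>\<close> along absolutely continuous trajectories.\<close>

subsection \<open>Absolutely continuous functions\<close>

lemma abs_continuous_onD:
  assumes "abs_continuous_on S f" "e > 0"
  obtains d where "d > 0"
    "\<And>D. D division_of \<Union>D \<Longrightarrow> \<Union>D \<subseteq> S \<Longrightarrow> (\<Sum>k\<in>D. Sup k - Inf k) < d \<Longrightarrow>
       (\<Sum>k\<in>D. norm (f (Sup k) - f (Inf k))) < e"
proof -
  obtain d where "d > 0" "\<forall>D. D division_of \<Union>D \<and> \<Union>D \<subseteq> S \<and> (\<Sum>k\<in>D. Sup k - Inf k) < d \<longrightarrow>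
       (\<Sum>k\<in>D. norm (f (Sup k) - f (Inf k))) < e"
    using assms unfolding abs_continuous_on_def by blast
  then show ?thesis by (intro that[of d]) auto
qed

lemma division_of_endpoints:
  fixes D :: "real set set"
  assumes "D division_of S" "k \<in> D"
  shows "Inf k \<in> k" "Sup k \<in> k" "Inf k \<le> Sup k"
proof -
  obtain a b where "k = cbox a b" "k \<noteq> {}"
    using division_ofD(3,4)[OF assms] by blast
  then show "Inf k \<in> k" "Sup k \<in> k" "Inf k \<le> Sup k"
    by auto
qed

text \<open>One criterion for all closure properties used here: on any division the increments of
  \<open>h\<close> sum to at most a constant times those of \<open>f\<close> and \<open>g\<close>.
  Two dominating functions are allowed so that a product can be compared with both of its
  factors.\<close>

lemma abs_continuous_on_dominated:
  assumes f: "abs_continuous_on S f" and g: "abs_continuous_on S g"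
    and h: "\<And>u v. u \<in> S \<Longrightarrow> v \<in> S \<Longrightarrow>
      norm (h v - h u) \<le> C * (norm (f v - f u) + norm (g v - g u))"
  shows "abs_continuous_on S h"
  unfolding abs_continuous_on_def
proof (intro allI impI)
  fix e :: real assume "e > 0"
  \<comment> \<open>\<open>C\<close> may be zero or negative; a positive replacement is needed to
    form \<open>e / (2 * c)\<close>.\<close>
  define c where "c = max C 1"
  have c: "c > 0" "C \<le> c" by (auto simp: c_def)
  have e': "e / (2 * c) > 0" using \<open>e > 0\<close> c by simp
  obtain d1 where d1: "d1 > 0"
    "\<And>D. D division_of \<Union>D \<Longrightarrow> \<Union>D \<subseteq> S \<Longrightarrow> (\<Sum>k\<in>D. Sup k - Inf k) < d1 \<Longrightarrow>
       (\<Sum>k\<in>D. norm (f (Sup k) - f (Inf k))) < e / (2 * c)"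
    by (rule abs_continuous_onD[OF f e']) blast
  obtain d2 where d2: "d2 > 0"
    "\<And>D. D division_of \<Union>D \<Longrightarrow> \<Union>D \<subseteq> S \<Longrightarrow> (\<Sum>k\<in>D. Sup k - Inf k) < d2 \<Longrightarrow>
       (\<Sum>k\<in>D. norm (g (Sup k) - g (Inf k))) < e / (2 * c)"
    by (rule abs_continuous_onD[OF g e']) blast
  show "\<exists>d>0. \<forall>D. D division_of \<Union>D \<and> \<Union>D \<subseteq> S \<and> (\<Sum>k\<in>D. Sup k - Inf k) < d \<longrightarrow>
      (\<Sum>k\<in>D. norm (h (Sup k) - h (Inf k))) < e"
  proof (intro exI[of _ "min d1 d2"] conjI allI impI)
    fix D assume D: "D division_of \<Union>D \<and> \<Union>D \<subseteq> S \<and> (\<Sum>k\<in>D. Sup k - Inf k) < min d1 d2"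
    have "(\<Sum>k\<in>D. norm (h (Sup k) - h (Inf k)))
        \<le> (\<Sum>k\<in>D. c * (norm (f (Sup k) - f (Inf k)) + norm (g (Sup k) - g (Inf k))))"
    proof (rule sum_mono)
      fix k assume k: "k \<in> D"
      have "Inf k \<in> S" "Sup k \<in> S"
        using division_of_endpoints[of D _ k] D k by blast+
      then have "norm (h (Sup k) - h (Inf k))
          \<le> C * (norm (f (Sup k) - f (Inf k)) + norm (g (Sup k) - g (Inf k)))"
        by (rule h)
      also have "\<dots> \<le> c * (norm (f (Sup k) - f (Inf k)) + norm (g (Sup k) - g (Inf k)))"
        using c by (intro mult_right_mono) auto
      finally show "norm (h (Sup k) - h (Inf k))
          \<le> c * (norm (f (Sup k) - f (Inf k)) + norm (g (Sup k) - g (Inf k)))" .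
    qed
    also have "\<dots> = c * ((\<Sum>k\<in>D. norm (f (Sup k) - f (Inf k))) + (\<Sum>k\<in>D. norm (g (Sup k) - g (Inf k))))"
      by (simp only: sum_distrib_left[symmetric] sum.distrib)
    also have "\<dots> < c * (e / (2 * c) + e / (2 * c))"
      using d1(2)[of D] d2(2)[of D] D c by (intro mult_strict_left_mono add_strict_mono) auto
    also have "\<dots> = e" using c by (simp add: field_simps)
    finally show "(\<Sum>k\<in>D. norm (h (Sup k) - h (Inf k))) < e" .
  qed (use d1 d2 in auto)
qed

lemma abs_continuous_on_ident: "abs_continuous_on S (\<lambda>t. t)"
  unfolding abs_continuous_on_def
proof (intro allI impI)
  fix e :: real assume "e > 0"
  have "(\<Sum>k\<in>D. norm (Sup k - Inf k)) = (\<Sum>k\<in>D. Sup k - Inf k)" if "D division_of \<Union>D" for D :: "real set set"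
    by (rule sum.cong) (use division_of_endpoints(3)[OF that] in auto)
  then show "\<exists>d>0. \<forall>D. D division_of \<Union>D \<and> \<Union>D \<subseteq> S \<and> (\<Sum>k\<in>D. Sup k - Inf k) < d \<longrightarrow>
      (\<Sum>k\<in>D. norm (Sup k - Inf k)) < e"
    using \<open>e > 0\<close> by auto
qed

lemma abs_continuous_on_lipschitz:
  assumes "L-lipschitz_on S f"
  shows "abs_continuous_on S f"
proof (rule abs_continuous_on_dominated[OF abs_continuous_on_ident abs_continuous_on_ident])
  fix u v assume "u \<in> S" "v \<in> S"
  then have "norm (f v - f u) \<le> L * norm (v - u)"
    using lipschitz_onD[OF assms, of v u] by (simp add: dist_norm)
  then show "norm (f v - f u) \<le> (L / 2) * (norm (v - u) + norm (v - u))"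
    by simp
qed

text \<open>A single interval is already a division, so the one-element case of the definition is
  uniform continuity.\<close>

lemma abs_continuous_on_imp_continuous_on:
  assumes "abs_continuous_on {a..b} f"
  shows "continuous_on {a..b} f"
  unfolding continuous_on_iff
proof (intro ballI allI impI)
  fix u and e :: real assume u: "u \<in> {a..b}" and "e > 0"
  obtain d where d: "d > 0"
    "\<And>D. D division_of \<Union>D \<Longrightarrow> \<Union>D \<subseteq> {a..b} \<Longrightarrow> (\<Sum>k\<in>D. Sup k - Inf k) < d \<Longrightarrow>
       (\<Sum>k\<in>D. norm (f (Sup k) - f (Inf k))) < e"
    by (rule abs_continuous_onD[OF assms \<open>e > 0\<close>]) blast
  have *: "norm (f y - f x) < e" if "x \<in> {a..b}" "y \<in> {a..b}" "x \<le> y" "y - x < d" for x y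
  proof -
    have "{{x..y}} division_of \<Union>{{x..y}}"
      using division_of_self[of x y] that by simp
    then show ?thesis
      using d(2)[of "{{x..y}}"] that by simp
  qed
  show "\<exists>d>0. \<forall>v\<in>{a..b}. dist v u < d \<longrightarrow> dist (f v) (f u) < e"
  proof (intro exI[of _ d] conjI ballI impI)
    fix v assume v: "v \<in> {a..b}" "dist v u < d"
    show "dist (f v) (f u) < e"
    proof (cases "u \<le> v")
      case True
      with *[of u v] u v show ?thesis by (simp add: dist_norm)
    next
      case False
      with *[of v u] u v show ?thesis by (simp add: dist_norm norm_minus_commute)
    qed
  qed (use d in auto)
qed

text \<open>Both factors are bounded, being continuous on a compact interval, and the Leibniz
  splitting of an increment then gives domination. It serves for the quadratic form
  \<open>x \<bullet> (Q *v x)\<close> and for its product with an exponential weight.\<close>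

lemma abs_continuous_on_bilinear:
  assumes p: "bounded_bilinear p"
    and f: "abs_continuous_on {a..b} f"
    and g: "abs_continuous_on {a..b} g"
  shows "abs_continuous_on {a..b} (\<lambda>t. p (f t) (g t))"
proof -
  interpret bounded_bilinear p by (fact p)
  have "bounded (f ` {a..b})" "bounded (g ` {a..b})"
    using f g by (auto intro!: compact_imp_bounded compact_continuous_image
        abs_continuous_on_imp_continuous_on)
  then obtain M N where MN: "\<And>t. t \<in> {a..b} \<Longrightarrow> norm (f t) \<le> M" "\<And>t. t \<in> {a..b} \<Longrightarrow> norm (g t) \<le> N"
    unfolding bounded_iff by blast
  obtain K where K: "K \<ge> 0" "\<And>x y. norm (p x y) \<le> norm x * norm y * K"
    using nonneg_bounded by blast
  show ?thesis
  proof (rule abs_continuous_on_dominated[OF f g])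
    fix u v assume uv: "u \<in> {a..b}" "v \<in> {a..b}"
    have le: "norm (f v - f u) * norm (g v) \<le> norm (f v - f u) * (max M N)"
      "norm (f u) * norm (g v - g u) \<le> max M N * norm (g v - g u)"
      using MN(2)[OF uv(2)] MN[OF uv(1)]
      by (auto intro!: mult_left_mono mult_right_mono[of _ _ "norm (g v - g u)"] simp: le_max_iff_disj)
    have "p (f v) (g v) - p (f u) (g u) = p (f v - f u) (g v) + p (f u) (g v - g u)"
      by (simp add: diff_left diff_right)
    then have "norm (p (f v) (g v) - p (f u) (g u)) \<le> norm (p (f v - f u) (g v)) + norm (p (f u) (g v - g u))"
      by (simp add: norm_triangle_ineq)
    also have "\<dots> \<le> norm (f v - f u) * norm (g v) * K + norm (f u) * norm (g v - g u) * K"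
      by (intro add_mono K)
    also have "\<dots> \<le> norm (f v - f u) * (max M N) * K + max M N * norm (g v - g u) * K"
      by (intro add_mono mult_right_mono[OF le(1) K(1)] mult_right_mono[OF le(2) K(1)])
    finally show "norm (p (f v) (g v) - p (f u) (g u)) \<le> (max M N * K) * (norm (f v - f u) + norm (g v - g u))"
      by (simp add: algebra_simps)
  qed
qed

text \<open>A straddle argument: on a fine tagged division, the intervals with a tag where the derivative
  exists contribute at most \<open>e (b - a)\<close>, and the others lie in an open set of small measure, so
  absolute continuity bounds their contribution by \<open>e\<close>.\<close>

lemma abs_continuous_on_nonpos_deriv_imp_le:
  fixes f :: "real \<Rightarrow> real"
  assumes "a \<le> b" and ac: "abs_continuous_on {a..b} f"
    and ae: "AE t in lebesgue. t \<in> {a..b} \<longrightarrow>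
      (\<exists>D\<le>0. (f has_vector_derivative D) (at t within {a..b}))"
  shows "f b \<le> f a"
proof (rule field_le_epsilon)
  fix e :: real assume "e > 0"
  \<comment> \<open>The summand 1 keeps the denominator positive when \<open>a = b\<close>.\<close>
  define e1 where "e1 = e / (2 * (b - a + 1))"
  have e1: "e1 > 0" "e1 * (b - a) \<le> e / 2"
    using \<open>a \<le> b\<close> \<open>e > 0\<close> by (auto simp: e1_def field_simps)
  have "e / 2 > 0" using \<open>e > 0\<close> by simp
  then obtain d where d: "d > 0"
    "\<And>D. D division_of \<Union>D \<Longrightarrow> \<Union>D \<subseteq> {a..b} \<Longrightarrow> (\<Sum>k\<in>D. Sup k - Inf k) < d \<Longrightarrow>
       (\<Sum>k\<in>D. norm (f (Sup k) - f (Inf k))) < e / 2"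
    by (rule abs_continuous_onD[OF ac]) blast
  obtain N where N: "N \<in> null_sets lebesgue"
    and "{t \<in> space lebesgue. \<not> (t \<in> {a..b} \<longrightarrow>
      (\<exists>D\<le>0. (f has_vector_derivative D) (at t within {a..b})))} \<subseteq> N"
    using ae unfolding eventually_ae_filter by blast
  then have nonpos_deriv: "\<exists>D\<le>0. (f has_vector_derivative D) (at t within {a..b})"
    if "t \<in> {a..b} - N" for t
    using that by auto
  obtain T where T: "open T" "N \<subseteq> T" "T - N \<in> lmeasurable" "emeasure lebesgue (T - N) < ennreal d"
    using sets_lebesgue_outer_open[of N d] N d(1) by auto
  have Tm: "T \<in> sets lebesgue" using T(1) by (intro sets_completionI_sets) simp
  have eT: "emeasure lebesgue T < ennreal d"
    using T(4) emeasure_Diff_null_set[OF N Tm] by simp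
  have TL: "T \<in> lmeasurable" using Tm eT less_trans[OF eT] by (auto simp: fmeasurable_def)
  then have mT: "measure lebesgue T < d"
    using eT d(1) by (simp add: emeasure_eq_measure2 ennreal_less_iff)
  \<comment> \<open>The gauge treats the two kinds of tag separately: around an exceptional tag the
    ball stays inside \<open>T\<close>, around a tag with a derivative it is small enough for the
    linear approximation. Any other point gets radius 1.\<close>
  have "\<exists>r>0. (t \<in> N \<longrightarrow> ball t r \<subseteq> T) \<and>
      (t \<in> {a..b} - N \<longrightarrow> (\<forall>u v. {u..v} \<subseteq> ball t r \<inter> {a..b} \<longrightarrow> t \<in> {u..v} \<longrightarrow>
         f v - f u \<le> e1 * (v - u)))" for t
  proof (cases "t \<in> {a..b} - N")
    case True
    then obtain D where D: "D \<le> 0" "(f has_vector_derivative D) (at t within {a..b})"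
      using nonpos_deriv by blast
    then obtain r where r: "r > 0" "\<And>y. y \<in> {a..b} \<Longrightarrow> norm (y - t) < r \<Longrightarrow>
        norm (f y - f t - (y - t) * D) \<le> e1 * norm (y - t)"
      unfolding has_vector_derivative_def has_derivative_within_alt using e1(1) by force
    \<comment> \<open>The tag lies between \<open>u\<close> and \<open>v\<close>, so the errors at
      the two ends add up to \<open>e1 * (v - u)\<close>, and the linear part
      \<open>(v - u) * D\<close> is nonpositive.\<close>
    have "f v - f u \<le> e1 * (v - u)" if uv: "{u..v} \<subseteq> ball t r \<inter> {a..b}" "t \<in> {u..v}" for u v
    proof -
      have "u \<in> {u..v}" "v \<in> {u..v}" using uv(2) by auto
      then have "u \<in> ball t r \<inter> {a..b}" "v \<in> ball t r \<inter> {a..b}" using uv(1) by blast+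
      then have "norm (f v - f t - (v - t) * D) \<le> e1 * norm (v - t)"
        "norm (f u - f t - (u - t) * D) \<le> e1 * norm (u - t)"
        using r(2)[of u] r(2)[of v] by (simp_all add: dist_norm abs_minus_commute[of t])
      moreover have "(v - u) * D \<le> 0" using uv(2) D(1) by (auto intro: mult_nonneg_nonpos)
      moreover have "norm (v - t) = v - t" "norm (u - t) = t - u" using uv(2) by auto
      ultimately show ?thesis by (simp add: algebra_simps abs_le_iff)
    qed
    with r(1) True show ?thesis by blast
  next
    case False
    show ?thesis
    proof (cases "t \<in> N")
      case True
      then show ?thesis using T(1,2) open_contains_ball[of T] by blast
    next
      case nN: False
      with False show ?thesis by (intro exI[of _ 1]) auto
    qed
  qed
  then obtain r where r: "\<And>t. r t > 0" "\<And>t. t \<in> N \<Longrightarrow> ball t (r t) \<subseteq> T"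
    "\<And>t u v. t \<in> {a..b} - N \<Longrightarrow> {u..v} \<subseteq> ball t (r t) \<inter> {a..b} \<Longrightarrow> t \<in> {u..v} \<Longrightarrow>
         f v - f u \<le> e1 * (v - u)"
    by metis
  have "gauge (\<lambda>t. ball t (r t))" using r(1) by (auto simp: gauge_def)
  then obtain p where p: "p tagged_division_of {a..b}" "(\<lambda>t. ball t (r t)) fine p"
    using fine_division_exists_real by blast
  have finp: "finite p" using p(1) by blast
  have pK: "\<exists>u v. K = {u..v} \<and> u \<le> v \<and> t \<in> {u..v}" if "(t, K) \<in> p" for t K
    using tagged_division_ofD(2,4)[OF p(1) that] by force
  define p1 where "p1 = {(t, K). (t, K) \<in> p \<and> t \<notin> N}"
  define p2 where "p2 = {(t, K). (t, K) \<in> p \<and> t \<in> N}"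
  have p12: "p = p1 \<union> p2" "p1 \<inter> p2 = {}" by (auto simp: p1_def p2_def)
  have fin: "finite p1" "finite p2" using finp p12 by auto
  have "(\<Sum>(t,K)\<in>p1. f (Sup K) - f (Inf K)) \<le> (\<Sum>(t,K)\<in>p1. e1 * (Sup K - Inf K))"
  proof (rule sum_mono, clarify)
    fix t K assume "(t, K) \<in> p1"
    then have tK: "(t, K) \<in> p" "t \<notin> N" by (auto simp: p1_def)
    obtain u v where K: "K = {u..v}" "u \<le> v" "t \<in> {u..v}" using pK[OF tK(1)] by blast
    have sub: "K \<subseteq> {a..b}" "K \<subseteq> ball t (r t)"
      using tagged_division_ofD(3)[OF p(1) tK(1)] fineD[OF p(2) tK(1)] by auto
    show "f (Sup K) - f (Inf K) \<le> e1 * (Sup K - Inf K)"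
      using r(3)[of t u v] K sub tK(2) by auto
  qed
  also have "\<dots> \<le> (\<Sum>(t,K)\<in>p. e1 * (Sup K - Inf K))"
  proof (rule sum_mono2[OF finp])
    show "p1 \<subseteq> p" using p12 by auto
    fix q assume "q \<in> p - p1"
    then obtain t K where "q = (t, K)" "(t, K) \<in> p" by (cases q) auto
    then show "0 \<le> (case q of (t, K) \<Rightarrow> e1 * (Sup K - Inf K))" using pK e1(1) by fastforce
  qed
  also have "\<dots> = e1 * (b - a)"
    using additive_tagged_division_1[OF \<open>a \<le> b\<close> p(1), of "\<lambda>x. x"]
    by (simp add: case_prod_unfold flip: sum_distrib_left)
  finally have S1: "(\<Sum>(t,K)\<in>p1. f (Sup K) - f (Inf K)) \<le> e / 2" using e1(2) by linarith
  have p2pd: "p2 tagged_partial_division_of {a..b}"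
    using p(1) p12 unfolding tagged_division_of_def by (meson Un_upper2 tagged_partial_division_subset)
  then have div: "snd ` p2 division_of \<Union>(snd ` p2)"
    by (rule partial_division_of_tagged_division)
  have sub: "\<Union>(snd ` p2) \<subseteq> {a..b}" "\<Union>(snd ` p2) \<subseteq> T"
    using tagged_partial_division_ofD(3)[OF p2pd] fineD[OF p(2)] r(2)
    by (fastforce simp: p2_def)+
  \<comment> \<open>The intervals with exceptional tags lie in \<open>T\<close>, so their total
    length is below \<open>d\<close> and absolute continuity applies to them.\<close>
  have "(\<Sum>k\<in>snd ` p2. Sup k - Inf k) = (\<Sum>k\<in>snd ` p2. measure lebesgue k)"
  proof (rule sum.cong)
    fix k assume "k \<in> snd ` p2"
    then obtain u v where "k = {u..v}" "u \<le> v" using pK p12 by force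
    then show "Sup k - Inf k = measure lebesgue k" by simp
  qed simp
  also have "\<dots> = measure lebesgue (\<Union>(snd ` p2))" by (rule content_division[OF div])
  also have "\<dots> \<le> measure lebesgue T"
    by (rule measure_mono_fmeasurable[OF sub(2) _ TL]) (use lmeasurable_division[OF div] in auto)
  finally have "(\<Sum>k\<in>snd ` p2. norm (f (Sup k) - f (Inf k))) < e / 2"
    using d(2)[OF div sub(1)] mT by linarith
  \<comment> \<open>One interval may carry several tags. Distinct pairs have disjoint interiors, so
    such an interval is a single point and contributes 0; forgetting the tags does not change the
    sum.\<close>
  moreover have "(\<Sum>(t,K)\<in>p2. norm (f (Sup K) - f (Inf K))) = (\<Sum>k\<in>snd ` p2. norm (f (Sup k) - f (Inf k)))"
  proof -
    have "norm (f (Sup (snd q)) - f (Inf (snd q))) = 0"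
      if q: "q \<in> p2" "q' \<in> p2" "q \<noteq> q'" "snd q = snd q'" for q q'
    proof -
      have "interior (snd q) = {}"
        using tagged_partial_division_ofD(5)[OF p2pd, of "fst q" "snd q" "fst q'" "snd q'"] q
        by (metis Int_absorb prod.collapse)
      moreover obtain u v where "snd q = {u..v}" "u \<le> v"
        using pK[of "fst q" "snd q"] q(1) p12 by auto
      ultimately show ?thesis by simp
    qed
    then show ?thesis
      by (subst sum.reindex_nontrivial[OF fin(2)]) (auto simp: case_prod_unfold)
  qed
  moreover have "(\<Sum>(t,K)\<in>p2. f (Sup K) - f (Inf K)) \<le> (\<Sum>(t,K)\<in>p2. norm (f (Sup K) - f (Inf K)))"
    by (rule sum_mono) auto
  ultimately have "(\<Sum>(t,K)\<in>p2. f (Sup K) - f (Inf K)) \<le> e / 2" by linarith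
  moreover have "f b - f a = (\<Sum>(t,K)\<in>p1. f (Sup K) - f (Inf K)) + (\<Sum>(t,K)\<in>p2. f (Sup K) - f (Inf K))"
    using additive_tagged_division_1[OF \<open>a \<le> b\<close> p(1), of f] p12 fin
    by (simp add: sum.union_disjoint)
  ultimately show "f b \<le> f a + e" using S1 by linarith
qed

subsection \<open>Quadratic Lyapunov functions\<close>

text \<open>Rescaling to the unit sphere. Only homogeneity of degree 2 is assumed, so the negative
  of a quadratic form is covered too, which turns the upper bound into a lower one.\<close>

lemma quadratic_le_of_unit:
  fixes q :: "'a::real_normed_vector \<Rightarrow> real"
  assumes hom: "\<And>c v. q (c *\<^sub>R v) = c\<^sup>2 * q v"
    and unit: "\<And>v. norm v = 1 \<Longrightarrow> q v \<le> k"
  shows "q v \<le> k * (norm v)\<^sup>2"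
proof (cases "v = 0")
  case True
  then show ?thesis using hom[of 0 0] by simp
next
  case False
  then have "q v = (norm v)\<^sup>2 * q ((1 / norm v) *\<^sub>R v)"
    by (simp flip: hom)
  also have "\<dots> \<le> (norm v)\<^sup>2 * k"
    using False by (intro mult_left_mono unit) auto
  finally show ?thesis by (simp add: mult.commute)
qed

text \<open>The two constants are the minimum and the maximum of the form on the compact unit
  sphere.\<close>

lemma pos_definite_quadratic_bounds:
  fixes Q :: "real^'n^'n"
  assumes "pos_definite Q"
  obtains m M where "m > 0" "M > 0"
    "\<And>v. m * (norm v)\<^sup>2 \<le> v \<bullet> (Q *v v)" "\<And>v. v \<bullet> (Q *v v) \<le> M * (norm v)\<^sup>2"
proof -
  let ?S = "sphere (0::real^'n) 1"
  let ?q = "\<lambda>v. v \<bullet> (Q *v v)"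
  have hom: "?q (c *\<^sub>R v) = c\<^sup>2 * ?q v" for c v
    by (simp add: matrix_vector_mult_scaleR power2_eq_square)
  have ne: "?S \<noteq> {}"
    by simp
  have cont: "continuous_on ?S ?q"
    by (intro continuous_intros linear_continuous_on matrix_vector_mul_bounded_linear)
  obtain v0 where v0: "v0 \<in> ?S" "\<And>v. v \<in> ?S \<Longrightarrow> ?q v0 \<le> ?q v"
    using continuous_attains_inf[OF compact_sphere ne cont] by blast
  obtain v1 where v1: "v1 \<in> ?S" "\<And>v. v \<in> ?S \<Longrightarrow> ?q v \<le> ?q v1"
    using continuous_attains_sup[OF compact_sphere ne cont] by blast
  have pos: "?q v0 > 0" "?q v1 > 0"
    using assms v0(1) v1(1) unfolding pos_definite_def
    by (metis dist_self mem_sphere zero_neq_one)+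
  have "- ?q v \<le> (- ?q v0) * (norm v)\<^sup>2" for v
    by (rule quadratic_le_of_unit[of "\<lambda>v. - ?q v"]) (use hom v0(2) in auto)
  moreover have "?q v \<le> ?q v1 * (norm v)\<^sup>2" for v
    by (rule quadratic_le_of_unit[of ?q]) (use hom v1(2) in auto)
  ultimately show ?thesis
    using pos by (intro that[of "?q v0" "?q v1"]) (auto simp: algebra_simps)
qed

text \<open>Comparison argument for \<open>V(x) = x' Q x\<close>: almost everywhere \<open>V' \<le> - 2 \<lambda> V + c s\<^sup>2\<close>, so
  \<open>exp (2 \<lambda> t) (V - c s\<^sup>2 / (2 \<lambda>))\<close> is nonincreasing.\<close>

lemma quadratic_lyapunov_imp_ISS_estimate:
  fixes Q :: "real^'n^'n" and A :: "real \<Rightarrow> real^'n^'n" and B :: "real^'n"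
  assumes Q: "pos_definite Q" and "\<alpha> > 0"
    and decay: "\<And>m v. m \<in> U \<Longrightarrow> 2 * ((Q *v v) \<bullet> (A m *v v)) \<le> - \<alpha> * (norm v)\<^sup>2"
  obtains K lam G where "K > 0" "lam > 0" "G > 0"
    "\<And>\<mu> u x s t. \<forall>t\<ge>0. \<mu> t \<in> U \<Longrightarrow> trajectory (\<lambda>t v. A (\<mu> t) *v v + u t *\<^sub>R B) x \<Longrightarrow>
       t \<ge> 0 \<Longrightarrow> \<forall>\<tau>\<in>{0..t}. \<bar>u \<tau>\<bar> \<le> s \<Longrightarrow>
       norm (x t) \<le> K * norm (x 0) * exp (- lam * t) + G * s"
proof -
  obtain m M where m: "m > 0" and M: "M > 0"
    and mM: "\<And>v. m * (norm v)\<^sup>2 \<le> v \<bullet> (Q *v v)" "\<And>v. v \<bullet> (Q *v v) \<le> M * (norm v)\<^sup>2"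
    by (rule pos_definite_quadratic_bounds[OF Q]) blast
  have "transpose Q = Q" using Q by (simp add: pos_definite_def)
  then have sym: "v \<bullet> (Q *v w) = (Q *v v) \<bullet> w" for v w
    by (metis dot_lmul_matrix transpose_matrix_vector)
  \<comment> \<open>The decay \<alpha> is split in halves. One half absorbs the input term by
    completing a square, which leaves \<open>c * s\<^sup>2\<close>; the other dominates
    \<open>2 * lam\<close> times the quadratic form, by its upper bound \<open>M\<close>.
    \<open>K\<close> and \<open>g\<close> arise on dividing by \<open>m\<close> and taking square
    roots.\<close>
  define b where "b = norm (Q *v B)"
  define c where "c = 2 * b\<^sup>2 / \<alpha>"
  define lam where "lam = \<alpha> / (4 * M)"
  define K where "K = sqrt (M / m)"
  define g where "g = sqrt (c / (2 * lam * m))"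
  have c: "c \<ge> 0" and lam: "lam > 0" and K: "K > 0" and g: "g \<ge> 0"
    using \<open>\<alpha> > 0\<close> m M by (auto simp: c_def lam_def K_def g_def)
  have V_decay: "2 * ((Q *v v) \<bullet> (A p *v v + w *\<^sub>R B)) + 2 * lam * (v \<bullet> (Q *v v)) \<le> c * s\<^sup>2"
    if "p \<in> U" "\<bar>w\<bar> \<le> s" for p w s v
  proof -
    have "\<bar>w * (v \<bullet> (Q *v B))\<bar> \<le> s * (norm v * b)"
      unfolding abs_mult b_def using that(2) by (intro mult_mono Cauchy_Schwarz_ineq2) auto
    then have "w * (v \<bullet> (Q *v B)) \<le> s * (norm v * b)" by linarith
    then have "2 * (w * ((Q *v v) \<bullet> B)) \<le> 2 * s * b * norm v"
      by (simp add: sym mult_ac)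
    moreover have "2 * s * b * norm v \<le> \<alpha> / 2 * (norm v)\<^sup>2 + c * s\<^sup>2"
    proof -
      have "0 \<le> \<alpha> / 2 * (norm v - 2 * b * s / \<alpha>)\<^sup>2"
        using \<open>\<alpha> > 0\<close> by simp
      also have "\<dots> = \<alpha> / 2 * (norm v)\<^sup>2 - 2 * s * b * norm v + c * s\<^sup>2"
        using \<open>\<alpha> > 0\<close> by (simp add: c_def field_simps power2_eq_square)
      finally show ?thesis by simp
    qed
    moreover have "2 * lam * (v \<bullet> (Q *v v)) \<le> \<alpha> / 2 * (norm v)\<^sup>2"
    proof -
      have "2 * lam * (v \<bullet> (Q *v v)) \<le> 2 * lam * (M * (norm v)\<^sup>2)"
        using lam by (intro mult_left_mono mM) auto
      also have "\<dots> = \<alpha> / 2 * (norm v)\<^sup>2"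
        using M by (simp add: lam_def)
      finally show ?thesis .
    qed
    ultimately show ?thesis
      using decay[OF that(1), of v] by (simp add: inner_add_right distrib_left)
  qed
  \<comment> \<open>\<open>g\<close> vanishes when \<open>B\<close> does, whereas a positive gain is
    required, hence \<open>g + 1\<close>.\<close>
  have "norm (x t) \<le> K * norm (x 0) * exp (- lam * t) + (g + 1) * s"
    if \<mu>: "\<forall>t\<ge>0. \<mu> t \<in> U" and x: "trajectory (\<lambda>t v. A (\<mu> t) *v v + u t *\<^sub>R B) x"
      and "t \<ge> 0" and s: "\<forall>\<tau>\<in>{0..t}. \<bar>u \<tau>\<bar> \<le> s" for \<mu> u x s t
  proof -
    have "\<bar>u 0\<bar> \<le> s" using s \<open>t \<ge> 0\<close> by simp
    then have "s \<ge> 0" by linarith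
    define k where "k = c * s\<^sup>2 / (2 * lam)"
    have "k \<ge> 0" using c lam by (simp add: k_def)
    define V where "V \<tau> = x \<tau> \<bullet> (Q *v x \<tau>)" for \<tau>
    define f where "f \<tau> = exp (2 * lam * \<tau>) * (V \<tau> - k)" for \<tau>
    have bil: "bounded_bilinear (\<lambda>v w. v \<bullet> (Q *v w))"
      by (rule bounded_bilinear.comp[OF bounded_bilinear_inner bounded_linear_ident
          matrix_vector_mul_bounded_linear])
    have "abs_continuous_on {0..t} x"
      using x \<open>t \<ge> 0\<close> by (simp add: trajectory_def)
    then have acV: "abs_continuous_on {0..t} V"
      unfolding V_def by (intro abs_continuous_on_bilinear[OF bil])
    then have acVk: "abs_continuous_on {0..t} (\<lambda>\<tau>. V \<tau> - k)"
      by (simp add: abs_continuous_on_def)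
    \<comment> \<open>The derivative of the weight is increasing, so its value at \<open>t\<close>
      is a Lipschitz constant on \<open>{0..t}\<close>.\<close>
    have "(exp (2 * lam * t) * (2 * lam))-lipschitz_on {0..t} (\<lambda>\<tau>. exp (2 * lam * \<tau>))"
    proof (rule bounded_derivative_imp_lipschitz)
      show "((\<lambda>\<tau>. exp (2 * lam * \<tau>)) has_derivative (\<lambda>h. h * (exp (2 * lam * \<tau>) * (2 * lam))))
          (at \<tau> within {0..t})" for \<tau>
        by (auto intro!: derivative_eq_intros)
      show "onorm (\<lambda>h. h * (exp (2 * lam * \<tau>) * (2 * lam))) \<le> exp (2 * lam * t) * (2 * lam)"
        if "\<tau> \<in> {0..t}" for \<tau>
        using that lam by (intro onorm_le) (auto simp: abs_mult intro!: mult_mono)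
    qed (use lam in auto)
    then have "abs_continuous_on {0..t} (\<lambda>\<tau>. exp (2 * lam * \<tau>))"
      by (rule abs_continuous_on_lipschitz)
    then have acf: "abs_continuous_on {0..t} f"
      unfolding f_def using acVk by (rule abs_continuous_on_bilinear[OF bounded_bilinear_mult])
    have "f t \<le> f 0"
    proof (rule abs_continuous_on_nonpos_deriv_imp_le[OF \<open>t \<ge> 0\<close> acf])
      have "AE \<tau> in lebesgue. 0 \<le> \<tau> \<longrightarrow>
          (x has_vector_derivative A (\<mu> \<tau>) *v x \<tau> + u \<tau> *\<^sub>R B) (at \<tau> within {0..})"
        using x by (simp add: trajectory_def)
      then show "AE \<tau> in lebesgue. \<tau> \<in> {0..t} \<longrightarrow>
          (\<exists>D\<le>0. (f has_vector_derivative D) (at \<tau> within {0..t}))"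
      proof eventually_elim
        case (elim \<tau>)
        show ?case
        proof
          assume \<tau>: "\<tau> \<in> {0..t}"
          define d where "d = A (\<mu> \<tau>) *v x \<tau> + u \<tau> *\<^sub>R B"
          have "(x has_vector_derivative d) (at \<tau> within {0..t})"
            using elim \<tau> unfolding d_def by (auto intro: has_vector_derivative_within_subset)
          from bounded_bilinear.has_vector_derivative[OF bil this this]
          have "(V has_vector_derivative 2 * ((Q *v x \<tau>) \<bullet> d)) (at \<tau> within {0..t})"
            unfolding V_def by (simp add: sym[of "x \<tau>" d] inner_commute[of d])
          then have DV: "(V has_real_derivative 2 * ((Q *v x \<tau>) \<bullet> d)) (at \<tau> within {0..t})"
            by (simp add: has_real_derivative_iff_has_vector_derivative)
          have "((\<lambda>\<tau>. exp (2 * lam * \<tau>)) has_real_derivative exp (2 * lam * \<tau>) * (2 * lam)) (at \<tau> within {0..t})"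
            by (auto intro!: derivative_eq_intros)
          from DERIV_mult'[OF this DERIV_diff[OF DV DERIV_const]]
          have "(f has_real_derivative exp (2 * lam * \<tau>) * (2 * ((Q *v x \<tau>) \<bullet> d) - 0)
              + exp (2 * lam * \<tau>) * (2 * lam) * (V \<tau> - k)) (at \<tau> within {0..t})"
            unfolding f_def .
          also have "exp (2 * lam * \<tau>) * (2 * ((Q *v x \<tau>) \<bullet> d) - 0)
              + exp (2 * lam * \<tau>) * (2 * lam) * (V \<tau> - k)
              = exp (2 * lam * \<tau>) * (2 * ((Q *v x \<tau>) \<bullet> d) + 2 * lam * V \<tau> - 2 * lam * k)"
            by (simp add: algebra_simps)
          also have "2 * lam * k = c * s\<^sup>2"
            using lam by (simp add: k_def)
          finally have "(f has_vector_derivative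
              exp (2 * lam * \<tau>) * (2 * ((Q *v x \<tau>) \<bullet> d) + 2 * lam * V \<tau> - c * s\<^sup>2)) (at \<tau> within {0..t})"
            by (simp add: has_real_derivative_iff_has_vector_derivative)
          moreover have "exp (2 * lam * \<tau>) * (2 * ((Q *v x \<tau>) \<bullet> d) + 2 * lam * V \<tau> - c * s\<^sup>2) \<le> 0"
            using V_decay[of "\<mu> \<tau>" "u \<tau>" s "x \<tau>"] \<mu> s \<tau>
            by (intro mult_nonneg_nonpos) (auto simp: d_def V_def)
          ultimately show "\<exists>D\<le>0. (f has_vector_derivative D) (at \<tau> within {0..t})"
            by blast
        qed
      qed
    qed
    \<comment> \<open>Undoing the exponential weight; the term with \<open>- k\<close> on the right
      is then dropped by its sign.\<close>
    then have "exp (- (2 * lam * t)) * f t \<le> exp (- (2 * lam * t)) * (V 0 - k)"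
      by (intro mult_left_mono) (auto simp: f_def)
    moreover have "exp (- (2 * lam * t)) * f t = V t - k"
      by (simp add: f_def exp_minus)
    moreover have "exp (- (2 * lam * t)) * k \<ge> 0" using \<open>k \<ge> 0\<close> by simp
    ultimately have "V t \<le> exp (- (2 * lam * t)) * V 0 + k"
      by (simp add: algebra_simps)
    also have "\<dots> \<le> exp (- (2 * lam * t)) * (M * (norm (x 0))\<^sup>2) + k"
      by (simp add: V_def mM)
    finally have "m * (norm (x t))\<^sup>2 \<le> exp (- (2 * lam * t)) * (M * (norm (x 0))\<^sup>2) + k"
      using mM(1)[of "x t"] by (simp add: V_def)
    then have "(norm (x t))\<^sup>2 \<le> (exp (- (2 * lam * t)) * (M * (norm (x 0))\<^sup>2) + k) / m"
      using m by (simp add: field_simps)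
    also have "\<dots> = M / m * (norm (x 0))\<^sup>2 * exp (- (2 * lam * t)) + k / m"
      by (simp add: add_divide_distrib)
    also have "M / m = K\<^sup>2" using m M by (simp add: K_def)
    also have "k / m = (g * s)\<^sup>2"
      using c lam m by (simp add: k_def g_def power_mult_distrib)
    also have "exp (- (2 * lam * t)) = (exp (- lam * t))\<^sup>2"
      by (simp add: power2_eq_square flip: exp_add)
    \<comment> \<open>The cross term of the square is nonnegative, so the square root separates the
      initial state from the input.\<close>
    also have "K\<^sup>2 * (norm (x 0))\<^sup>2 * (exp (- lam * t))\<^sup>2 + (g * s)\<^sup>2
        \<le> (K * norm (x 0) * exp (- lam * t) + g * s)\<^sup>2"
      using K g \<open>s \<ge> 0\<close> by (simp add: power2_sum power_mult_distrib)
    finally have "norm (x t) \<le> K * norm (x 0) * exp (- lam * t) + g * s"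
      by (rule power2_le_imp_le) (use K g \<open>s \<ge> 0\<close> in auto)
    then show ?thesis using \<open>s \<ge> 0\<close> by (simp add: algebra_simps)
  qed
  then show ?thesis
    using K lam g by (intro that[of K lam "g + 1"]) auto
qed

subsection \<open>Compactness and perturbation\<close>

text \<open>A perturbation argument in the spirit of Finsler's lemma: where \<open>g \<ge> 0\<close>, \<open>f\<close> is bounded away
  from \<open>0\<close> by compactness, so a small multiple of \<open>g\<close> cannot compensate it.\<close>

lemma eventually_perturbation_neg:
  fixes f g :: "'a::topological_space \<Rightarrow> real"
  assumes S: "compact S" and f: "continuous_on S f" and g: "continuous_on S g"
    and f_le: "\<And>s. s \<in> S \<Longrightarrow> f s \<le> 0"
    and g_less: "\<And>s. s \<in> S \<Longrightarrow> f s = 0 \<Longrightarrow> g s < 0"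
  shows "\<forall>\<^sub>F \<xi> in at_right 0. \<exists>\<alpha>>0. \<forall>s\<in>S. f s + \<xi> * g s \<le> - \<alpha>"
proof -
  have neg: "\<forall>\<^sub>F \<xi> in at_right 0. \<forall>s\<in>S. f s + \<xi> * g s < 0"
  proof (cases "\<exists>s\<in>S. g s \<ge> 0")
    case False
    then have "f s + \<xi> * g s < 0" if "\<xi> > 0" "s \<in> S" for \<xi> s
      using that f_le[of s] mult_pos_neg[of \<xi> "g s"] by (fastforce simp: not_le)
    then show ?thesis
      unfolding eventually_at_right_field by (intro exI[of _ 1]) auto
  next
    case True
    then obtain s1 where s1: "s1 \<in> S" "\<And>s. s \<in> S \<Longrightarrow> g s \<le> g s1"
      using continuous_attains_sup[OF S _ g] by blast
    \<comment> \<open>The maximum of \<open>f\<close> over the points with \<open>g \<ge> 0\<close>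
      is sought among value pairs in the plane, where the constraint is closed whatever the topology
      of the domain.\<close>
    define X where "X = (\<lambda>s. (f s, g s)) ` S \<inter> {p. snd p \<ge> 0}"
    have "compact X"
      unfolding X_def
      by (intro compact_Int_closed compact_continuous_image continuous_on_Pair S f g)
        (simp add: closed_Collect_le continuous_on_snd)
    moreover have "X \<noteq> {}" using True by (auto simp: X_def)
    ultimately obtain p where p: "p \<in> X" "\<And>q. q \<in> X \<Longrightarrow> fst q \<le> fst p"
      using continuous_attains_sup[of X fst] continuous_on_fst[OF continuous_on_id] by blast
    have fp: "fst p < 0"
    proof -
      obtain s where s: "s \<in> S" "g s \<ge> 0" "fst p = f s" using p(1) by (auto simp: X_def)
      then show ?thesis using f_le[OF s(1)] g_less[OF s(1)] by linarith
    qed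
    have f_p: "f s \<le> fst p" if "s \<in> S" "g s \<ge> 0" for s
      using p(2)[of "(f s, g s)"] that by (auto simp: X_def)
    \<comment> \<open>The threshold makes \<open>\<xi> * g s\<close> smaller than the gap
      \<open>- fst p\<close>; the summand 1 avoids division by 0.\<close>
    have "f s + \<xi> * g s < 0" if "\<xi> > 0" "\<xi> < - fst p / (\<bar>g s1\<bar> + 1)" "s \<in> S" for \<xi> s
    proof (cases "g s \<ge> 0")
      case True
      have "\<xi> * g s \<le> \<xi> * (\<bar>g s1\<bar> + 1)"
        using s1(2)[OF that(3)] that(1) by (intro mult_left_mono) auto
      also have "\<dots> < - fst p" using that(2) by (simp add: field_simps)
      finally show ?thesis using f_p[OF that(3) True] by simp
    next
      case False
      then show ?thesis using f_le[OF that(3)] that(1) by (simp add: add_nonpos_neg mult_pos_neg)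
    qed
    then show ?thesis
      unfolding eventually_at_right_field using fp
      by (intro exI[of _ "- fst p / (\<bar>g s1\<bar> + 1)"]) (auto simp: divide_neg_pos)
  qed
  \<comment> \<open>Second use of compactness, now for fixed \<xi>: the maximum of a pointwise
    negative continuous function is negative, which gives a uniform \<alpha>.\<close>
  then show ?thesis
  proof eventually_elim
    case (elim \<xi>)
    show ?case
    proof (cases "S = {}")
      case True
      then show ?thesis by (intro exI[of _ 1]) auto
    next
      case False
      have "continuous_on S (\<lambda>s. f s + \<xi> * g s)"
        by (intro continuous_intros f g)
      then obtain s0 where "s0 \<in> S" "\<And>s. s \<in> S \<Longrightarrow> f s + \<xi> * g s \<le> f s0 + \<xi> * g s0"
        using continuous_attains_sup[OF S False] by blast
      then show ?thesis
        using elim by (intro exI[of _ "- (f s0 + \<xi> * g s0)"]) (auto simp: add.commute)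
    qed
  qed
qed

lemma matrix_inv_eqI:
  fixes M N :: "real^'n^'n"
  assumes "M ** N = mat 1"
  shows "matrix_inv M = N"
proof -
  have NM: "N ** M = mat 1" using assms by (simp add: matrix_left_right_inverse)
  have "invertible M" using assms NM unfolding invertible_def by blast
  then have "M ** matrix_inv M = mat 1"
    unfolding matrix_inv_def invertible_def by (rule someI_ex[THEN conjunct1])
  then have "N ** (M ** matrix_inv M) = N" by simp
  then show ?thesis by (simp add: matrix_mul_assoc NM)
qed

subsection \<open>Matrix computations\<close>

lemma vector_4 [simp]:
  "(vector [w, x, y, z] :: 'a::zero^4) $ 1 = w"
  "(vector [w, x, y, z] :: 'a::zero^4) $ 2 = x"
  "(vector [w, x, y, z] :: 'a::zero^4) $ 3 = y"
  "(vector [w, x, y, z] :: 'a::zero^4) $ 4 = z"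
  unfolding vector_def by simp_all

lemma matrix_vector_mult_4:
  fixes M :: "real^4^4"
  shows "(M *v v) $ i = M $ i $ 1 * v $ 1 + M $ i $ 2 * v $ 2 + M $ i $ 3 * v $ 3 + M $ i $ 4 * v $ 4"
  by (simp add: matrix_vector_mult_def sum_4)

lemma inner_4: "v \<bullet> w = v $ 1 * w $ 1 + v $ 2 * w $ 2 + v $ 3 * w $ 3 + v $ 4 * w $ 4"
  for v w :: "real^4"
  by (simp add: inner_vec_def sum_4)

lemma P_mat_mult_vec:
  "P_mat L1 L2 C1 C2 *v v = vector [L1 / 2 * v $ 1, L2 / 2 * v $ 2, C1 / 2 * v $ 3, C2 / 2 * v $ 4]"
  by (simp add: vec_eq_iff forall_4 matrix_vector_mult_4 P_mat_def)

lemma H_mat_mult_vec: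
  "H_mat h13 h14 h23 h24 *v v = vector
     [h13 * v $ 3 + h14 * v $ 4, h23 * v $ 3 + h24 * v $ 4,
      h13 * v $ 1 + h23 * v $ 2, h14 * v $ 1 + h24 * v $ 2]"
  by (simp add: vec_eq_iff forall_4 matrix_vector_mult_4 H_mat_def)

lemma matrix_inv_P_mat:
  assumes "L1 > 0" "L2 > 0" "C1 > 0" "C2 > 0"
  shows "matrix_inv (P_mat L1 L2 C1 C2) = vector
     [vector [2 / L1, 0, 0, 0], vector [0, 2 / L2, 0, 0],
      vector [0, 0, 2 / C1, 0], vector [0, 0, 0, 2 / C2]]"
  using assms
  by (intro matrix_inv_eqI)
    (simp add: vec_eq_iff forall_4 matrix_matrix_mult_def sum_4 P_mat_def mat_def)

lemma A_mat_mult_vec: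
  assumes "L1 > 0" "L2 > 0" "C1 > 0" "C2 > 0"
  shows "A_mat L1 L2 C1 C2 R \<mu> *v v = vector
     [(\<mu> - 1/2) * v $ 3 / L1,
      ((\<mu> + 1/2) * v $ 3 + v $ 4) / L2,
      ((1/2 - \<mu>) * v $ 1 - (1/2 + \<mu>) * v $ 2) / C1,
      (- v $ 2 - v $ 4 / R) / C2]"
  by (simp add: vec_eq_iff forall_4 matrix_vector_mult_4 A_mat_def matrix_inv_P_mat[OF assms]
      matrix_matrix_mult_def sum_4 A0q_def E0q_def)
    (simp add: add_divide_distrib diff_divide_distrib algebra_simps)

text \<open>Multiplication by \<open>4 * a\<close>, which is negative, completes the square and
  leaves the negated discriminant as the coefficient of \<open>y\<^sup>2\<close>.\<close>

lemma quadratic_form_neg: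
  fixes a b c x y :: real
  assumes "a < 0" "b\<^sup>2 < 4 * a * c" "x \<noteq> 0 \<or> y \<noteq> 0"
  shows "a * x\<^sup>2 + b * (x * y) + c * y\<^sup>2 < 0"
proof -
  have "4 * a * (a * x\<^sup>2 + b * (x * y) + c * y\<^sup>2) = (2 * a * x + b * y)\<^sup>2 + (4 * a * c - b\<^sup>2) * y\<^sup>2"
    by (simp add: power2_eq_square algebra_simps)
  also have "\<dots> > 0"
  proof (cases "y = 0")
    case True
    then show ?thesis using assms(1,3) by simp
  next
    case False
    then show ?thesis using assms(2) by (intro add_nonneg_pos mult_pos_pos) auto
  qed
  finally show ?thesis using assms(1) by (simp add: zero_less_mult_iff)
qed

lemma transpose_add: "transpose (M + N) = transpose M + transpose N" for M N :: "'a::semiring_1^'n^'m"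
  by (simp add: transpose_def vec_eq_iff)

lemma P_mat_sym: "transpose (P_mat L1 L2 C1 C2) = P_mat L1 L2 C1 C2"
  by (simp add: vec_eq_iff forall_4 transpose_def P_mat_def)

lemma H_mat_sym: "transpose (H_mat h13 h14 h23 h24) = H_mat h13 h14 h23 h24"
  by (simp add: vec_eq_iff forall_4 transpose_def H_mat_def)

text \<open>Passage from the scalar inequality, in which all estimates are made, to the Loewner
  order: symmetry of \<open>Q\<close> makes the two summands contribute equally to the quadratic
  form.\<close>

lemma loewner_lyapunov_leI:
  fixes A Q :: "real^'n^'n"
  assumes "transpose Q = Q" and le: "\<And>v. 2 * ((Q *v v) \<bullet> (A *v v)) \<le> - \<alpha> * (norm v)\<^sup>2"
  shows "transpose A ** Q + Q ** A \<preceq> (- \<alpha>) *\<^sub>R mat 1"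
proof -
  let ?M = "transpose A ** Q + Q ** A"
  have M: "transpose ?M = ?M"
    by (simp add: transpose_add matrix_transpose_mul assms(1) add.commute)
  have I: "transpose ((- \<alpha>) *\<^sub>R mat 1 :: real^'n^'n) = (- \<alpha>) *\<^sub>R mat 1"
    by (simp add: vec_eq_iff transpose_def mat_def)
  have "v \<bullet> (?M *v v) = 2 * ((Q *v v) \<bullet> (A *v v))" for v
  proof -
    have "v \<bullet> (transpose A *v (Q *v v)) = (A *v v) \<bullet> (Q *v v)"
      by (metis dot_lmul_matrix inner_commute transpose_matrix_vector)
    moreover have "v \<bullet> (Q *v (A *v v)) = (Q *v v) \<bullet> (A *v v)"
      using dot_lmul_matrix[of v Q "A *v v"] transpose_matrix_vector[of Q v] assms(1) by simp
    ultimately show ?thesis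
      by (simp add: matrix_vector_mult_add_rdistrib inner_add_right inner_commute
          flip: matrix_vector_mul_assoc)
  qed
  moreover have "v \<bullet> (((- \<alpha>) *\<^sub>R mat 1 :: real^'n^'n) *v v) = - \<alpha> * (norm v)\<^sup>2" for v
    by (simp only: scaleR_matrix_vector_assoc[symmetric] matrix_vector_mul_lid inner_scaleR_right
        power2_norm_eq_inner)
  ultimately have "0 \<le> v \<bullet> (((- \<alpha>) *\<^sub>R mat 1 - ?M) *v v)" for v
    using le[of v] by (simp add: matrix_vector_mult_diff_rdistrib inner_diff_right)
  moreover have "transpose ((- \<alpha>) *\<^sub>R mat 1 - ?M) = (- \<alpha>) *\<^sub>R mat 1 - ?M"
    using M I by (simp add: transpose_def vec_eq_iff)
  ultimately show ?thesis
    using M I by (simp add: loewner_le_def pos_semidefinite_def)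
qed

subsection \<open>The inverter model\<close>

locale semi_quasi_Z_source_inverter =
  fixes L\<^sub>1 L\<^sub>2 C\<^sub>1 C\<^sub>2 R \<epsilon> mubar :: real
    and h13 h14 h23 h24 :: real
  assumes pos: "L\<^sub>1 > 0" "L\<^sub>2 > 0" "C\<^sub>1 > 0" "C\<^sub>2 > 0" "R > 0"
    and eps: "0 < \<epsilon>" "\<epsilon> \<le> 1/2"
    and mubar: "mubar = 1/2 - \<epsilon>"
    and h13: "h13 < 0"
    and h14: "h14 = - (C\<^sub>2 * (h13 - h23) / (2 * C\<^sub>1))"
    and h23: "h23 < (L\<^sub>2 / L\<^sub>1) * ((1 - \<epsilon>) / \<epsilon>) * h13"
    and h24: "h24 > (C\<^sub>2 / C\<^sub>1) * (((h23 - h13)\<^sup>2 * mubar\<^sup>2 + h13 * h23) / (- 4 * \<epsilon> * h13))"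
    and h24_bound_pos:
      "(C\<^sub>2 / C\<^sub>1) * (((h23 - h13)\<^sup>2 * mubar\<^sup>2 + h13 * h23) / (- 4 * \<epsilon> * h13)) > 0"
begin

abbreviation "P \<equiv> P_mat L\<^sub>1 L\<^sub>2 C\<^sub>1 C\<^sub>2"
abbreviation "A \<equiv> A_mat L\<^sub>1 L\<^sub>2 C\<^sub>1 C\<^sub>2 R"
abbreviation "H \<equiv> H_mat h13 h14 h23 h24"

text \<open>Multiplication by \<open>P\<close> removes the inductances and capacitances, and the
  skew part drops out of the form. Only the dissipation in the load is left, which vanishes exactly
  on \<open>v $ 4 = 0\<close>.\<close>

lemma P_mat_A_mat_form: "(P *v v) \<bullet> (A m *v v) = - (v $ 4)\<^sup>2 / (2 * R)"
  using pos by (simp add: P_mat_mult_vec A_mat_mult_vec inner_4 field_simps power2_eq_square)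

text \<open>The worst case is \<open>m = - mubar\<close>, where the weights are
  \<open>m + 1/2 = \<epsilon>\<close> and \<open>1/2 - m = 1 - \<epsilon>\<close>; there negativity
  is precisely the bound on \<open>h23\<close>.\<close>

lemma x3_coeff_neg:
  assumes "m \<in> {-mubar..mubar}"
  shows "h13 * (m - 1/2) / L\<^sub>1 + h23 * (m + 1/2) / L\<^sub>2 < 0"
proof -
  have "(L\<^sub>2 / L\<^sub>1) * ((1 - \<epsilon>) / \<epsilon>) > 0"
    using eps pos by (intro mult_pos_pos divide_pos_pos) auto
  from mult_pos_neg[OF this h13] have "h23 < 0" using h23 by linarith
  have m: "\<epsilon> \<le> m + 1/2" "1/2 - m \<le> 1 - \<epsilon>" using assms mubar by auto
  have "h23 * (m + 1/2) / L\<^sub>2 \<le> h23 * \<epsilon> / L\<^sub>2"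
    using m(1) \<open>h23 < 0\<close> pos by (intro divide_right_mono mult_left_mono_neg) auto
  also have "\<dots> < ((L\<^sub>2 / L\<^sub>1) * ((1 - \<epsilon>) / \<epsilon>) * h13) * \<epsilon> / L\<^sub>2"
    using h23 eps pos by (intro divide_strict_right_mono mult_strict_right_mono) auto
  also have "\<dots> = h13 * (1 - \<epsilon>) / L\<^sub>1"
    using eps pos by (simp add: field_simps)
  also have "\<dots> \<le> h13 * (1/2 - m) / L\<^sub>1"
    using m(2) h13 pos by (intro divide_right_mono mult_left_mono_neg) auto
  finally have "h23 * (m + 1/2) / L\<^sub>2 < h13 * (1/2 - m) / L\<^sub>1" .
  moreover have "h13 * (m - 1/2) / L\<^sub>1 = - (h13 * (1/2 - m) / L\<^sub>1)"
    by (metis minus_diff_eq mult_minus_right minus_divide_left)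
  ultimately show ?thesis by linarith
qed

text \<open>With \<open>k = C\<^sub>1 h\<^sub>2\<^sub>4 / C\<^sub>2\<close>, the inequality amounts to
  \<open>(h\<^sub>1\<^sub>3 - h\<^sub>2\<^sub>3)\<^sup>2 m\<^sup>2 + h\<^sub>1\<^sub>3 h\<^sub>2\<^sub>3 < - 4 h\<^sub>1\<^sub>3 (1/2 - m) k\<close>, where \<open>1/2 - m \<ge> \<epsilon>\<close>.\<close>

lemma x1_x2_discriminant:
  assumes "m \<in> {-mubar..mubar}"
  shows "((h13 + h23) * m)\<^sup>2
    < 4 * (h13 * (1/2 - m)) * (- h23 * (1/2 + m) - C\<^sub>1 * h24 / C\<^sub>2)"
proof -
  define k where "k = C\<^sub>1 * h24 / C\<^sub>2"
  let ?N = "(h23 - h13)\<^sup>2 * mubar\<^sup>2 + h13 * h23"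
  have d: "- 4 * \<epsilon> * h13 > 0" using eps h13 by (simp add: mult_pos_neg)
  have "h24 > 0" using h24 h24_bound_pos by linarith
  then have k: "k > 0" using pos by (simp add: k_def)
  have "?N / (- 4 * \<epsilon> * h13) = (C\<^sub>1 / C\<^sub>2) * ((C\<^sub>2 / C\<^sub>1) * (?N / (- 4 * \<epsilon> * h13)))"
    using pos by simp
  also have "\<dots> < (C\<^sub>1 / C\<^sub>2) * h24"
    using h24 pos by (intro mult_strict_left_mono) auto
  finally have "?N / (- 4 * \<epsilon> * h13) < k" by (simp add: k_def)
  then have "?N < k * (- 4 * \<epsilon> * h13)" using d by (simp only: pos_divide_less_eq)
  also have "\<dots> \<le> k * (- 4 * (1/2 - m) * h13)"
    using assms mubar k h13 by (intro mult_left_mono[OF mult_right_mono_neg]) auto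
  finally have "?N < k * (- 4 * (1/2 - m) * h13)" .
  moreover have "(h23 - h13)\<^sup>2 * m\<^sup>2 \<le> (h23 - h13)\<^sup>2 * mubar\<^sup>2"
    using assms by (intro mult_left_mono) (auto simp: abs_le_square_iff[symmetric])
  ultimately have "(h23 - h13)\<^sup>2 * m\<^sup>2 + h13 * h23 < k * (- 4 * (1/2 - m) * h13)"
    by linarith
  \<comment> \<open>Since \<open>4 * (1/2 - m) * (1/2 + m) = 1 - 4 * m\<^sup>2\<close>, collecting
    the terms in \<open>m\<^sup>2\<close> turns \<open>(h13 + h23)\<^sup>2\<close> into
    \<open>(h13 + h23)\<^sup>2 - 4 * h13 * h23 = (h23 - h13)\<^sup>2\<close>.\<close>
  then show ?thesis
    unfolding k_def[symmetric] by (simp add: power2_eq_square algebra_simps)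
qed

lemma H_mat_A_mat_form_neg:
  assumes m: "m \<in> {-mubar..mubar}" and v: "v \<noteq> 0" "v $ 4 = 0"
  shows "(H *v v) \<bullet> (A m *v v) < 0"
proof -
  \<comment> \<open>The coefficients of the binary form, multiplied by \<open>C\<^sub>1\<close>. In
    the mixed one the contribution of \<open>h14\<close> cancels \<open>(h23 - h13) / 2\<close>, the
    part free of \<open>m\<close>.\<close>
  define a where "a = h13 * (1/2 - m)"
  define b where "b = - ((h13 + h23) * m)"
  define c where "c = - h23 * (1/2 + m) - C\<^sub>1 * h24 / C\<^sub>2"
  define q where "q = a * (v $ 1)\<^sup>2 + b * (v $ 1 * v $ 2) + c * (v $ 2)\<^sup>2"
  define w where "w = h13 * (m - 1/2) / L\<^sub>1 + h23 * (m + 1/2) / L\<^sub>2"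
  have form: "(H *v v) \<bullet> (A m *v v) = w * (v $ 3)\<^sup>2 + q / C\<^sub>1"
    using pos v(2) unfolding h14 w_def q_def a_def b_def c_def
    by (simp add: H_mat_mult_vec A_mat_mult_vec inner_4 field_simps power2_eq_square)
  have a: "a < 0" using m mubar h13 eps by (auto simp: a_def intro!: mult_neg_pos)
  have disc: "b\<^sup>2 < 4 * a * c"
    using x1_x2_discriminant[OF m] by (simp add: a_def b_def c_def power_mult_distrib)
  have w: "w < 0" using x3_coeff_neg[OF m] by (simp add: w_def)
  show ?thesis
  proof (cases "v $ 1 \<noteq> 0 \<or> v $ 2 \<noteq> 0")
    case True
    then have "q < 0" unfolding q_def by (rule quadratic_form_neg[OF a disc])
    then have "q / C\<^sub>1 < 0" using pos by (simp add: divide_neg_pos)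
    moreover have "w * (v $ 3)\<^sup>2 \<le> 0" using w by (simp add: mult_nonpos_nonneg)
    ultimately show ?thesis unfolding form by linarith
  next
    case False
    then have "v $ 3 \<noteq> 0" using v by (auto simp: vec_eq_iff forall_4)
    then have "w * (v $ 3)\<^sup>2 < 0" using w by (simp add: mult_neg_pos)
    then show ?thesis unfolding form q_def using False by simp
  qed
qed

text \<open>The perturbation lemma applied to the negated forms. The form of \<open>P\<close> has no
  zero on the sphere, so the condition on \<open>H\<close> there is vacuous.\<close>

lemma eventually_pos_definite:
  "\<forall>\<^sub>F \<xi> in at_right 0. pos_definite (P + \<xi> *\<^sub>R H)"
proof -
  let ?S = "sphere (0::real^4) 1"
  have P_pos: "v \<bullet> (P *v v) > 0" if "v \<noteq> 0" for v
  proof -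
    have "v \<bullet> (P *v v) = (L\<^sub>1 * (v $ 1)\<^sup>2 + L\<^sub>2 * (v $ 2)\<^sup>2 + C\<^sub>1 * (v $ 3)\<^sup>2 + C\<^sub>2 * (v $ 4)\<^sup>2) / 2"
      by (simp add: P_mat_mult_vec inner_4 power2_eq_square)
    moreover have "v $ 1 \<noteq> 0 \<or> v $ 2 \<noteq> 0 \<or> v $ 3 \<noteq> 0 \<or> v $ 4 \<noteq> 0"
      using that by (auto simp: vec_eq_iff forall_4)
    then have "L\<^sub>1 * (v $ 1)\<^sup>2 + L\<^sub>2 * (v $ 2)\<^sup>2 + C\<^sub>1 * (v $ 3)\<^sup>2 + C\<^sub>2 * (v $ 4)\<^sup>2 > 0"
      using pos by (smt (verit) mult_pos_pos mult_nonneg_nonneg zero_less_power2 zero_le_power2)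
    ultimately show ?thesis by simp
  qed
  have cont: "continuous_on ?S (\<lambda>v. - (v \<bullet> (M *v v)))" for M :: "real^4^4"
    by (intro continuous_intros linear_continuous_on matrix_vector_mul_bounded_linear)
  have "\<forall>\<^sub>F \<xi> in at_right 0. \<exists>\<alpha>>0. \<forall>v\<in>?S. - (v \<bullet> (P *v v)) + \<xi> * - (v \<bullet> (H *v v)) \<le> - \<alpha>"
  proof (rule eventually_perturbation_neg)
    show "- (v \<bullet> (P *v v)) \<le> 0" if "v \<in> ?S" for v
      using P_pos[of v] by (cases "v = 0") auto
    show "- (v \<bullet> (H *v v)) < 0" if "v \<in> ?S" "- (v \<bullet> (P *v v)) = 0" for v
      using P_pos[of v] that by (cases "v = 0") auto
  qed (auto intro: cont)
  then show ?thesis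
  proof eventually_elim
    case (elim \<xi>)
    let ?Q = "P + \<xi> *\<^sub>R H"
    obtain \<alpha> where \<alpha>: "\<alpha> > 0" "\<And>v. norm v = 1 \<Longrightarrow> - (v \<bullet> (P *v v)) + \<xi> * - (v \<bullet> (H *v v)) \<le> - \<alpha>"
      using elim by auto
    have Qv: "v \<bullet> (?Q *v v) = v \<bullet> (P *v v) + \<xi> * (v \<bullet> (H *v v))" for v
      by (simp add: matrix_vector_mult_add_rdistrib inner_add_right flip: scaleR_matrix_vector_assoc)
    have le: "- (v \<bullet> (?Q *v v)) \<le> - \<alpha> * (norm v)\<^sup>2" for v
    proof (rule quadratic_le_of_unit)
      show "- ((c *\<^sub>R v) \<bullet> (?Q *v (c *\<^sub>R v))) = c\<^sup>2 * - (v \<bullet> (?Q *v v))" for c v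
        by (simp add: matrix_vector_mult_scaleR power2_eq_square)
      show "- (v \<bullet> (?Q *v v)) \<le> - \<alpha>" if "norm v = 1" for v
        unfolding Qv using \<alpha>(2)[OF that] by simp
    qed
    have "v \<bullet> (?Q *v v) > 0" if "v \<noteq> 0" for v
    proof -
      have "\<alpha> * (norm v)\<^sup>2 > 0" using that \<alpha>(1) by simp
      then show ?thesis using le[of v] by linarith
    qed
    moreover have "transpose ?Q = ?Q"
      by (simp add: transpose_add transpose_scalar P_mat_sym H_mat_sym)
    ultimately show ?case by (simp add: pos_definite_def)
  qed
qed

text \<open>Compactness is used on the sphere times the interval of admissible \<open>m\<close>, so
  that neither the range of \<xi> nor \<alpha> depends on \<open>m\<close>. The zeros of the
  unperturbed form are the points with \<open>v $ 4 = 0\<close>, where \<open>H\<close> supplies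
  negativity.\<close>

lemma eventually_lyapunov_decay:
  "\<forall>\<^sub>F \<xi> in at_right 0. \<exists>\<alpha>>0. \<forall>m\<in>{-mubar..mubar}. \<forall>v.
     2 * (((P + \<xi> *\<^sub>R H) *v v) \<bullet> (A m *v v)) \<le> - \<alpha> * (norm v)\<^sup>2"
proof -
  let ?S = "sphere (0::real^4) 1 \<times> {-mubar..mubar}"
  let ?f = "\<lambda>(v, m). 2 * ((P *v v) \<bullet> (A m *v v))"
  let ?g = "\<lambda>(v, m). 2 * ((H *v v) \<bullet> (A m *v v))"
  have "\<forall>\<^sub>F \<xi> in at_right 0. \<exists>\<alpha>>0. \<forall>s\<in>?S. ?f s + \<xi> * ?g s \<le> - \<alpha>"
  proof (rule eventually_perturbation_neg)
    show "compact ?S" by (intro compact_Times) auto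
    show "continuous_on ?S ?f"
      unfolding case_prod_unfold P_mat_A_mat_form using pos by (intro continuous_intros) auto
    show "continuous_on ?S ?g"
      unfolding case_prod_unfold H_mat_mult_vec A_mat_mult_vec[OF pos(1-4)] inner_4 vector_4
      using pos by (intro continuous_intros) auto
    show "?f s \<le> 0" for s
      using pos by (auto simp: P_mat_A_mat_form split: prod.split)
    show "?g s < 0" if "s \<in> ?S" "?f s = 0" for s
    proof -
      obtain v m where s: "s = (v, m)" by fastforce
      have "v \<noteq> 0" "v $ 4 = 0" "m \<in> {-mubar..mubar}"
        using that pos by (auto simp: s P_mat_A_mat_form)
      then show ?thesis
        using H_mat_A_mat_form_neg[of m v] by (simp add: s)
    qed
  qed
  then show ?thesis
  proof eventually_elim
    case (elim \<xi>)
    let ?q = "\<lambda>m v. 2 * (((P + \<xi> *\<^sub>R H) *v v) \<bullet> (A m *v v))"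
    obtain \<alpha> where \<alpha>: "\<alpha> > 0" "\<And>s. s \<in> ?S \<Longrightarrow> ?f s + \<xi> * ?g s \<le> - \<alpha>"
      using elim by blast
    have split_form: "?q m v = ?f (v, m) + \<xi> * ?g (v, m)" for m v
      by (simp add: matrix_vector_mult_add_rdistrib inner_add_left flip: scaleR_matrix_vector_assoc)
    have "?q m v \<le> - \<alpha> * (norm v)\<^sup>2" if "m \<in> {-mubar..mubar}" for m v
    proof (rule quadratic_le_of_unit)
      show "?q m (c *\<^sub>R v) = c\<^sup>2 * ?q m v" for c v
        by (simp add: matrix_vector_mult_scaleR power2_eq_square)
      show "?q m v \<le> - \<alpha>" if "norm v = 1" for v
        unfolding split_form using \<open>m \<in> _\<close> that by (intro \<alpha>(2)) auto
    qed
    then show ?case using \<alpha>(1) by blast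
  qed
qed

end

section \<open>Comparison functions and the assembled stability estimates\<close>

lemma neg_scalar_mat_less_0:
  assumes "\<alpha> > 0"
  shows "(- \<alpha>) *\<^sub>R mat 1 \<prec> (0 :: real^'n^'n)"
proof -
  have "v \<bullet> ((\<alpha> *\<^sub>R mat 1 :: real^'n^'n) *v v) = \<alpha> * (norm v)\<^sup>2" for v
    by (simp only: scaleR_matrix_vector_assoc[symmetric] matrix_vector_mul_lid inner_scaleR_right
        power2_norm_eq_inner)
  then show ?thesis
    using assms by (simp add: loewner_less_def pos_definite_def) (simp add: transpose_def vec_eq_iff mat_def)
qed

lemma class_KL_exp:
  assumes "K > 0" "lam > 0"
  shows "class_KL (\<lambda>r s. K * r * exp (- lam * s))"
  unfolding class_KL_def class_K_def
proof (intro conjI allI impI)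
  show "continuous_on ({0..} \<times> {0..}) (\<lambda>(r, s). K * r * exp (- lam * s))"
    unfolding case_prod_unfold by (intro continuous_intros)
  show "continuous_on {0..} (\<lambda>r. K * r * exp (- lam * s))" for s
    by (intro continuous_intros)
  show "strict_mono_on {0..} (\<lambda>r. K * r * exp (- lam * s))" for s
    using assms by (auto simp: strict_mono_on_def)
  show "antimono_on {0..} (\<lambda>s. K * r * exp (- lam * s))" if "r \<ge> 0" for r
    using assms that by (auto simp: monotone_on_def intro!: mult_left_mono)
  have "((\<lambda>s. K * r * exp (- (lam * s))) \<longlongrightarrow> K * r * 0) at_top" for r
    using assms(2)
    by (intro tendsto_intros filterlim_compose[OF exp_at_bot] filterlim_compose[OF filterlim_uminus_at_bot_at_top]
        filterlim_tendsto_pos_mult_at_top[OF tendsto_const] filterlim_ident)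
  then show "((\<lambda>s. K * r * exp (- lam * s)) \<longlongrightarrow> 0) at_top" for r
    by simp
qed simp

theorem theorem1:
  fixes L\<^sub>1 L\<^sub>2 C\<^sub>1 C\<^sub>2 R V\<^sub>i\<^sub>n \<epsilon> mubar :: real
    and h13 h14 h23 h24 :: real
    and U :: "real set"
    and P H :: "real^4^4" and A :: "real \<Rightarrow> real^4^4" and B :: "real^4"
  assumes "L\<^sub>1 > 0" "L\<^sub>2 > 0" "C\<^sub>1 > 0" "C\<^sub>2 > 0" "R > 0"
    and "P = P_mat L\<^sub>1 L\<^sub>2 C\<^sub>1 C\<^sub>2"
    and "A = A_mat L\<^sub>1 L\<^sub>2 C\<^sub>1 C\<^sub>2 R"
    and "B = B_vec L\<^sub>1 L\<^sub>2 C\<^sub>1 C\<^sub>2 V\<^sub>i\<^sub>n"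
    and "0 < \<epsilon>" "\<epsilon> \<le> 1/2"
    and "mubar = 1/2 - \<epsilon>"
    and "U = {-mubar..mubar}"
    and "H = H_mat h13 h14 h23 h24"
    and "h13 < 0"
    and "h14 = - (C\<^sub>2 * (h13 - h23) / (2 * C\<^sub>1))"
    and "h23 < (L\<^sub>2 / L\<^sub>1) * ((1 - \<epsilon>) / \<epsilon>) * h13"
    and "(L\<^sub>2 / L\<^sub>1) * ((1 - \<epsilon>) / \<epsilon>) * h13 < 0"
    and "h24 > (C\<^sub>2 / C\<^sub>1) * (((h23 - h13)\<^sup>2 * mubar\<^sup>2 + h13 * h23) / (- 4 * \<epsilon> * h13))"
    and "(C\<^sub>2 / C\<^sub>1) * (((h23 - h13)\<^sup>2 * mubar\<^sup>2 + h13 * h23) / (- 4 * \<epsilon> * h13)) > 0"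
  shows
    "(\<forall>\<^sub>F \<xi> in at_right 0.
        0 \<prec> P + \<xi> *\<^sub>R H \<and>
        (\<exists>\<alpha>>0. \<forall>\<mu>\<in>U.
           transpose (A \<mu>) ** (P + \<xi> *\<^sub>R H) + (P + \<xi> *\<^sub>R H) ** A \<mu> \<preceq> (- \<alpha>) *\<^sub>R mat 1 \<and>
           (- \<alpha>) *\<^sub>R mat 1 \<prec> (0 :: real^4^4)))
     \<and>
     (\<exists>K lam. K > 0 \<and> lam > 0 \<and>
        (\<forall>\<mu> x. (\<forall>t\<ge>0. \<mu> t \<in> U) \<longrightarrow> trajectory (\<lambda>t v. A (\<mu> t) *v v) x \<longrightarrow>
           (\<forall>t\<ge>0. norm (x t) \<le> K * norm (x 0) * exp (- lam * t))))
     \<and>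
     (\<exists>K lam G. K > 0 \<and> lam > 0 \<and> G > 0 \<and>
        (\<forall>\<mu> u x. (\<forall>t\<ge>0. \<mu> t \<in> U) \<longrightarrow> trajectory (\<lambda>t v. A (\<mu> t) *v v + u t *\<^sub>R B) x \<longrightarrow>
           (\<forall>t\<ge>0. ereal (norm (x t)) \<le>
              ereal (K * norm (x 0) * exp (- lam * t)) + ereal G * (SUP \<tau>\<in>{0..t}. ereal \<bar>u \<tau>\<bar>)))
        \<and>
        uniformly_ISS U (\<lambda>m w v. A m *v v + w *\<^sub>R B)
          (\<lambda>r s. K * r * exp (- lam * s)) (\<lambda>r. G * r)
        \<and>
        (\<forall>\<mu> x. (\<forall>t\<ge>0. \<mu> t \<in> U) \<longrightarrow> trajectory (\<lambda>t v. A (\<mu> t) *v v + \<mu> t *\<^sub>R B) x \<longrightarrow>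
           (\<forall>t\<ge>0. norm (x t) \<le> K * norm (x 0) * exp (- lam * t) + G * mubar)))"
proof -
  interpret inverter: semi_quasi_Z_source_inverter L\<^sub>1 L\<^sub>2 C\<^sub>1 C\<^sub>2 R \<epsilon> mubar h13 h14 h23 h24
    by unfold_locales (use assms in auto)
  have eventually_lyapunov: "\<forall>\<^sub>F \<xi> in at_right 0. pos_definite (P + \<xi> *\<^sub>R H) \<and>
      (\<exists>\<alpha>>0. \<forall>m\<in>U. \<forall>v. 2 * (((P + \<xi> *\<^sub>R H) *v v) \<bullet> (A m *v v)) \<le> - \<alpha> * (norm v)\<^sup>2)"
    using eventually_conj[OF inverter.eventually_pos_definite inverter.eventually_lyapunov_decay] assms
    by simp
  have "\<forall>\<^sub>F \<xi> in at_right 0. 0 \<prec> P + \<xi> *\<^sub>R H \<and>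
      (\<exists>\<alpha>>0. \<forall>\<mu>\<in>U.
        transpose (A \<mu>) ** (P + \<xi> *\<^sub>R H) + (P + \<xi> *\<^sub>R H) ** A \<mu> \<preceq> (- \<alpha>) *\<^sub>R mat 1 \<and>
        (- \<alpha>) *\<^sub>R mat 1 \<prec> (0 :: real^4^4))"
    using eventually_lyapunov
  proof eventually_elim
    case (elim \<xi>)
    then obtain \<alpha> where \<alpha>: "\<alpha> > 0"
      "\<And>m v. m \<in> U \<Longrightarrow> 2 * (((P + \<xi> *\<^sub>R H) *v v) \<bullet> (A m *v v)) \<le> - \<alpha> * (norm v)\<^sup>2"
      by blast
    have "transpose (0 :: real^4^4) = 0" "transpose (P + \<xi> *\<^sub>R H) = P + \<xi> *\<^sub>R H"
      using elim by (simp_all add: pos_definite_def transpose_def vec_eq_iff[of _ 0])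
    then have "0 \<prec> P + \<xi> *\<^sub>R H"
      using elim by (simp add: loewner_less_def)
    moreover have "transpose (A m) ** (P + \<xi> *\<^sub>R H) + (P + \<xi> *\<^sub>R H) ** A m \<preceq> (- \<alpha>) *\<^sub>R mat 1"
      if "m \<in> U" for m
      using elim \<alpha>(2)[OF that] by (intro loewner_lyapunov_leI) (auto simp: pos_definite_def)
    ultimately show ?case
      using \<alpha>(1) neg_scalar_mat_less_0[OF \<alpha>(1)] by blast
  qed
  \<comment> \<open>One admissible \<xi> is fixed, and the constants drawn from it serve all
    trajectory estimates at once.\<close>
  moreover obtain \<xi> \<alpha> where lyap: "pos_definite (P + \<xi> *\<^sub>R H)" "\<alpha> > 0"
    "\<And>m v. m \<in> U \<Longrightarrow> 2 * (((P + \<xi> *\<^sub>R H) *v v) \<bullet> (A m *v v)) \<le> - \<alpha> * (norm v)\<^sup>2"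
    using eventually_happens'[OF trivial_limit_at_right_real eventually_lyapunov] by blast
  obtain K lam G where KlG: "K > 0" "lam > 0" "G > 0"
    and est: "\<And>\<mu> u x s t. \<forall>t\<ge>0. \<mu> t \<in> U \<Longrightarrow> trajectory (\<lambda>t v. A (\<mu> t) *v v + u t *\<^sub>R B) x \<Longrightarrow>
       t \<ge> 0 \<Longrightarrow> \<forall>\<tau>\<in>{0..t}. \<bar>u \<tau>\<bar> \<le> s \<Longrightarrow>
       norm (x t) \<le> K * norm (x 0) * exp (- lam * t) + G * s"
    by (rule quadratic_lyapunov_imp_ISS_estimate[where A = A and U = U and B = B, OF lyap])
      (assumption, rule that)
  \<comment> \<open>The unforced system is the case of zero input with bound 0.\<close>
  have "norm (x t) \<le> K * norm (x 0) * exp (- lam * t)"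
    if "\<forall>t\<ge>0. \<mu> t \<in> U" "trajectory (\<lambda>t v. A (\<mu> t) *v v) x" "t \<ge> 0" for \<mu> x t
    using est[of \<mu> "\<lambda>_. 0" x t 0] that by simp
  moreover have "ereal (norm (x t)) \<le>
      ereal (K * norm (x 0) * exp (- lam * t)) + ereal G * (SUP \<tau>\<in>{0..t}. ereal \<bar>u \<tau>\<bar>)"
    if "\<forall>t\<ge>0. \<mu> t \<in> U" "trajectory (\<lambda>t v. A (\<mu> t) *v v + u t *\<^sub>R B) x" "t \<ge> 0" for \<mu> u x t
  proof -
    let ?S = "SUP \<tau>\<in>{0..t}. ereal \<bar>u \<tau>\<bar>"
    have u_le: "ereal \<bar>u \<tau>\<bar> \<le> ?S" if "\<tau> \<in> {0..t}" for \<tau>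
      using that by (rule SUP_upper)
    \<comment> \<open>The supremum is extended real because the input may be unbounded. If it is
      infinite, positivity of \<open>G\<close> makes the right side infinite; it is never minus
      infinity, as \<tau> = 0 is in the range.\<close>
    show ?thesis
    proof (cases ?S)
      case (real s)
      then have "\<forall>\<tau>\<in>{0..t}. \<bar>u \<tau>\<bar> \<le> s" using u_le by simp
      from est[OF that this] show ?thesis unfolding real by simp
    next
      case PInf
      then show ?thesis using KlG(3) by simp
    next
      case MInf
      then show ?thesis using u_le[of 0] \<open>t \<ge> 0\<close> by simp
    qed
  qed
  moreover have "uniformly_ISS U (\<lambda>m w v. A m *v v + w *\<^sub>R B)
      (\<lambda>r s. K * r * exp (- lam * s)) (\<lambda>r. G * r)"
    unfolding uniformly_ISS_def
  proof (intro conjI allI impI)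
    show "class_KL (\<lambda>r s. K * r * exp (- lam * s))"
      by (rule class_KL_exp[OF KlG(1,2)])
    show "class_K (\<lambda>r. G * r)"
      using KlG(3) by (auto simp: class_K_def strict_mono_on_def intro!: continuous_intros)
    fix \<mu> u x t
    assume "\<forall>t\<ge>0. \<mu> t \<in> U" "\<forall>t\<ge>0. bdd_above ((\<lambda>\<tau>. \<bar>u \<tau>\<bar>) ` {0..t})"
      "trajectory (\<lambda>t v. A (\<mu> t) *v v + u t *\<^sub>R B) x" "0 \<le> (t :: real)"
    then show "norm (x t) \<le> K * norm (x 0) * exp (- lam * t) + G * (SUP \<tau>\<in>{0..t}. \<bar>u \<tau>\<bar>)"
      by (intro est[of \<mu> u]) (auto intro: cSUP_upper)
  qed
  \<comment> \<open>Here \<mu> is its own input, bounded by \<open>mubar\<close> through its range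
    \<open>U\<close>.\<close>
  moreover have "norm (x t) \<le> K * norm (x 0) * exp (- lam * t) + G * mubar"
    if "\<forall>t\<ge>0. \<mu> t \<in> U" "trajectory (\<lambda>t v. A (\<mu> t) *v v + \<mu> t *\<^sub>R B) x" "t \<ge> 0" for \<mu> x t
    using that by (intro est[of \<mu> \<mu>]) (auto simp: \<open>U = _\<close> abs_le_iff)
  ultimately show ?thesis
    using KlG
    by (intro conjI exI[where x = K, OF exI[where x = lam]] exI[where x = K, OF exI[where x = lam, OF exI[where x = G]]])
      simp_all
qed

end
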